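(* Let $L,M$ be nonnegative integers and $(a,b)$ a pair of coprime integers with $1\leq b<a$. Then \[ \sum_{j\in\mathbb{Z}}(-1)^j q^{\frac{1}{2}j((2ab+1)j+1)}\mathcal{B}(L,M,aj,bj)=F_{a,b}(L,M). \]
   Context: Notation: $(x;q)_n=\prod_{i=0}^{n-1}(1-xq^i)$, $(q)_n=(q;q)_n$; $\begin{bmatrix}n\\ m\end{bmatrix}=\frac{(q)_n}{(q)_m(q)_{n-m}}$ if $m,n-m$ are nonnegative integers, $0$ otherwise. $\mathcal{B}(L,M,a,b)=\begin{bmatrix}L+M+a-b\\ L+a\end{bmatrix}\begin{bmatrix}L+M-a+b\\ L-a\end{bmatrix}$. Continued-fraction data: for coprime $1\le b<a$ let $\mathrm{cf}(a,b)=(a/b-1)^{s}$ with $s=1$ if $a>2b$, $s=-1$ if $a<2b$, $s=0$ if $a=2b$ (so $\mathrm{cf}(2,1)=1$). Write $\mathrm{cf}(a,b)=[a_0,\dots,a_n]=a_0+\cfrac{1}{a_1+\cfrac{1}{\cdots+\frac{1}{a_n}}}$ with positive integers $a_i$, choosing the representation with $a_n\ge 2$ when $(a,b)\ne(2,1)$ (and $\mathrm{cf}(2,1)=[1]$); $n$ is called the order. Put $t_0=0$, $t_j=a_0+\dots+a_{j-1}$ for $1\le j\le n+1$, and $d=d(a,b)=t_{n+1}$. Let $\mathcal I$ be the $d\times d$ matrix with $\mathcal I_{j,k}=\delta_{j,k+1}+\delta_{j,k-1}$ if $j\notin\{t_1,\dots,t_{n+1}\}$ and $\mathcal I_{j,k}=\delta_{j,k+1}+\delta_{j,k}-\delta_{j,k-1}$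 if $j\in\{t_1,\dots,t_{n+1}\}$, and $C=C(a,b)=2I-\mathcal I$. Let $\tau_j=2$ for $1\le j<d$ and $\tau_d=1$. For $m=(m_1,\dots,m_d)\in\mathbb Z_{\ge0}^d$ write $m^TCm=\sum_{j,k}m_jC_{j,k}m_k$ and $n_j=L\delta_{j,1}-\sum_{k=1}^dC_{j,k}m_k$. Define, for $a\le 2b$, $F_{a,b}(L,M)=\sum_{m\in\mathbb Z_{\ge0}^d}q^{m^TCm}\begin{bmatrix}2L+M-m_1\\ 2L\end{bmatrix}\prod_{j=1}^d\begin{bmatrix}\tau_jm_j+n_j\\ \tau_jm_j\end{bmatrix}$, and for $a>2b$, $F_{a,b}(L,M)=\sum_{m\in\mathbb Z_{\ge0}^d}q^{L(L-2m_1)+m^TCm}\begin{bmatrix}L+M+m_1\\ 2L\end{bmatrix}\prod_{j=1}^d\begin{bmatrix}\tau_jm_j+n_j\\ \tau_jm_j\end{bmatrix}$. *)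

theory Defs
  imports "HOL-Computational_Algebra.Polynomial" "HOL-Computational_Algebra.Fraction_Field"
          "HOL-Library.Groups_Big_Fun"
begin

definition qpoch :: "'a::field \<Rightarrow> 'a \<Rightarrow> nat \<Rightarrow> 'a" where
  "qpoch q x n = (\<Prod>i<n. 1 - x * q ^ i)"

definition qfac :: "'a::field \<Rightarrow> nat \<Rightarrow> 'a" where
  "qfac q n = qpoch q q n"

definition qbinom :: "'a::field \<Rightarrow> int \<Rightarrow> int \<Rightarrow> 'a" where
  "qbinom q n m = (if 0 \<le> m \<and> m \<le> n
      then qfac q (nat n) / (qfac q (nat m) * qfac q (nat (n - m))) else 0)"

definition Bq :: "'a::field \<Rightarrow> int \<Rightarrow> int \<Rightarrow> int \<Rightarrow> int \<Rightarrow> 'a" where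
  "Bq q L M a b = qbinom q (L + M + a - b) (L + a) * qbinom q (L + M - a + b) (L - a)"

definition qvar :: "int poly fract" where
  "qvar = Fract [:0, 1:] 1"

definition cf_val :: "nat \<Rightarrow> nat \<Rightarrow> rat" where
  "cf_val a b = (if a > 2 * b then of_nat a / of_nat b - 1
                 else if a < 2 * b then inverse (of_nat a / of_nat b - 1) else 1)"

fun cfval :: "nat list \<Rightarrow> rat" where
  "cfval [] = 0"
| "cfval [x] = of_nat x"
| "cfval (x # y # ys) = of_nat x + 1 / cfval (y # ys)"

definition cf_list :: "nat \<Rightarrow> nat \<Rightarrow> nat list" where
  "cf_list a b = (THE xs. xs \<noteq> [] \<and> (\<forall>x\<in>set xs. 0 < x) \<and> cfval xs = cf_val a b \<and>
       (if (a, b) = (2, 1) then xs = [1] else 2 \<le> last xs))"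

definition tpt :: "nat \<Rightarrow> nat \<Rightarrow> nat \<Rightarrow> nat" where
  "tpt a b j = sum_list (take j (cf_list a b))"

definition dab :: "nat \<Rightarrow> nat \<Rightarrow> nat" where
  "dab a b = tpt a b (length (cf_list a b))"

definition Tset :: "nat \<Rightarrow> nat \<Rightarrow> nat set" where
  "Tset a b = {tpt a b j | j. 1 \<le> j \<and> j \<le> length (cf_list a b)}"

definition dlt :: "bool \<Rightarrow> int" where
  "dlt P = (if P then 1 else 0)"

(* the matrix \<I>, indices 1..d *)
definition Imat :: "nat \<Rightarrow> nat \<Rightarrow> nat \<Rightarrow> nat \<Rightarrow> int" where
  "Imat a b j k = (if j \<notin> Tset a b then dlt (j = k + 1) + dlt (k = j + 1)
                   else dlt (j = k + 1) + dlt (j = k) - dlt (k = j + 1))"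

definition Cmat :: "nat \<Rightarrow> nat \<Rightarrow> nat \<Rightarrow> nat \<Rightarrow> int" where
  "Cmat a b j k = 2 * dlt (j = k) - Imat a b j k"

definition tau :: "nat \<Rightarrow> nat \<Rightarrow> nat \<Rightarrow> int" where
  "tau a b j = (if j < dab a b then 2 else 1)"

definition quadC :: "nat \<Rightarrow> nat \<Rightarrow> (nat \<Rightarrow> nat) \<Rightarrow> int" where
  "quadC a b m = (\<Sum>j\<in>{1..dab a b}. \<Sum>k\<in>{1..dab a b}. int (m j) * Cmat a b j k * int (m k))"

definition nvec :: "nat \<Rightarrow> nat \<Rightarrow> nat \<Rightarrow> (nat \<Rightarrow> nat) \<Rightarrow> nat \<Rightarrow> int" where
  "nvec a b L m j = int L * dlt (j = 1) - (\<Sum>k\<in>{1..dab a b}. Cmat a b j k * int (m k))"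

definition prodterm :: "'a::field \<Rightarrow> nat \<Rightarrow> nat \<Rightarrow> nat \<Rightarrow> (nat \<Rightarrow> nat) \<Rightarrow> 'a" where
  "prodterm q a b L m = (\<Prod>j\<in>{1..dab a b}.
      qbinom q (tau a b j * int (m j) + nvec a b L m j) (tau a b j * int (m j)))"

(* F_{a,b}(L,M): sum over m \<in> Z_{\<ge>0}^d, encoded as functions nat \<Rightarrow> nat supported on {1..d};
   Sum_any is the sum of a finitely supported family *)
definition Fab :: "'a::field \<Rightarrow> nat \<Rightarrow> nat \<Rightarrow> nat \<Rightarrow> nat \<Rightarrow> 'a" where
  "Fab q a b L M = Sum_any (\<lambda>m :: nat \<Rightarrow> nat.
     if (\<forall>k. k \<notin> {1..dab a b} \<longrightarrow> m k = 0) then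
       (if a \<le> 2 * b then
          q powi quadC a b m * qbinom q (2 * int L + int M - int (m 1)) (2 * int L) * prodterm q a b L m
        else
          q powi (int L * (int L - 2 * int (m 1)) + quadC a b m)
            * qbinom q (int L + int M + int (m 1)) (2 * int L) * prodterm q a b L m)
     else 0)"

end

theory Submission
  imports Defs
begin

text \<open>
  Every coprime pair with \<open>1 \<le> b < a\<close> is reached from \<open>(1, 1)\<close> by the two moves
  \<open>(a, b) \<mapsto> (a + b, a)\<close> and \<open>(a, b) \<mapsto> (a + b, b)\<close>. The \<open>q\<close>-Saalschuetz sum yields the Burge transform
  \[ \sum_i q^{i^2} {2L+M-i \brack 2L} B(L-i,i,a,b) = q^{b^2} B(L,M,a+b,b), \]
  which, together with \<open>B(L,M,a,b) = B(M,L,b,a)\<close>, carries the left-hand side along both moves.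
  The sum over \<open>m\<close> obeys the same recursion when the new summation variable \<open>i\<close> is taken as the
  new \<open>m\<^sub>1\<close>: both moves lead to the same continued fraction, obtained from that of \<open>(a, b)\<close> by
  prepending \<open>1\<close> if \<open>a < 2b\<close> and by incrementing the first entry if \<open>a \<ge> 2b\<close>. At the root,
  \<open>\<Sum>\<^sub>j (-1)\<^sup>j q\<^bsup>j(3j+1)/2\<^esup> B(L,M,j,j)\<close> collapses to a single binomial coefficient by the
  \<open>q\<close>-Vandermonde sum and the \<open>q\<close>-binomial theorem.
\<close>

section \<open>Gaussian binomial coefficients and the Burge transform\<close>

lemma qbinom_eq_0: "m < 0 \<or> n < m \<Longrightarrow> qbinom q n m = 0"
  by (auto simp: qbinom_def)

lemma qbinom_symmetric: "qbinom q n (n - m) = qbinom q n m"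
  by (auto simp: qbinom_def mult.commute)

lemma qfac_Suc: "qfac q (Suc n) = (1 - q ^ Suc n) * qfac q n"
  by (simp add: qfac_def qpoch_def mult.commute)

text \<open>Complementing the lower entry of each Gaussian binomial exchanges the two factors'
  roles. This turns the Burge transform ending in \<open>(a + b, b)\<close> into one ending in
  \<open>(a + b, a)\<close>.\<close>

lemma Bq_swap: "Bq q L M a b = Bq q M L b a"
proof -
  have "qbinom q (L + M + a - b) (L + a) = qbinom q (M + L - b + a) (M - b)"
    using qbinom_symmetric[of q "L + M + a - b" "L + a"] by (simp add: algebra_simps)
  moreover have "qbinom q (L + M - a + b) (L - a) = qbinom q (M + L + b - a) (M + b)"
    using qbinom_symmetric[of q "L + M - a + b" "L - a"] by (simp add: algebra_simps)
  ultimately show ?thesis by (simp add: Bq_def)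
qed

lemma Bq_uminus: "Bq q L M (- a) (- b) = Bq q L M a b"
  by (simp add: Bq_def mult.commute)

text \<open>The two lower entries are \<open>L + a\<close> and \<open>L - a\<close>, their
  complements are \<open>M - b\<close> and \<open>M + b\<close>; one of these four is negative. All
  sums over j are finite for this reason.\<close>

lemma Bq_eq_0: "L < \<bar>a\<bar> \<or> M < \<bar>b\<bar> \<Longrightarrow> Bq q L M a b = 0"
  unfolding Bq_def by (cases "L + a < 0"; cases "L - a < 0"; cases "M + b < 0"; cases "M - b < 0")
    (auto simp: qbinom_eq_0)

text \<open>A nonzero q that is no root of unity: q-factorials can be cancelled and negative powers
  multiply as expected.\<close>

locale generic_q =
  fixes q :: "'a::field"
  assumes q_nonzero: "q \<noteq> 0"
    and q_power_neq_1: "0 < n \<Longrightarrow> q ^ n \<noteq> 1"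
begin

lemma qfac_nonzero: "qfac q n \<noteq> 0"
proof (induction n)
  case 0
  then show ?case by (simp add: qfac_def qpoch_def)
next
  case (Suc n)
  then show ?case using q_power_neq_1[of "Suc n"] by (simp add: qfac_Suc del: power_Suc)
qed

lemma qbinom_0_right: "0 \<le> n \<Longrightarrow> qbinom q n 0 = 1"
  using qfac_nonzero by (simp add: qbinom_def) (simp add: qfac_def qpoch_def)

lemma qbinom_self: "0 \<le> n \<Longrightarrow> qbinom q n n = 1"
  using qbinom_0_right[of n] qbinom_symmetric[of q n 0] by simp

lemma powi_mult_powi: "q powi m * q powi n = q powi (m + n)"
  using q_nonzero by (simp add: power_int_add)

text \<open>The recurrence fails at \<open>n = -1\<close>, \<open>r = 0\<close>, where the left side
  is 1 and the right side 0.\<close>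

lemma qbinom_pascal:
  assumes "0 \<le> n"
  shows "qbinom q (n + 1) r = qbinom q n r + q powi (n + 1 - r) * qbinom q n (r - 1)"
proof -
  consider "r < 0 \<or> n + 1 < r" | "r = 0" | "r = n + 1" "0 < r" | "1 \<le> r" "r \<le> n" by linarith
  then show ?thesis
  proof cases
    case 1
    then show ?thesis by (auto simp: qbinom_eq_0)
  next
    case 2
    with assms show ?thesis by (simp add: qbinom_0_right qbinom_eq_0)
  next
    case 3
    with assms show ?thesis by (simp add: qbinom_self qbinom_eq_0)
  next
    case 4
    define k where "k = nat (r - 1)"
    define l where "l = nat (n - r)"
    have r: "r = int k + 1" and n: "n = int k + int l + 1" using 4 by (auto simp: k_def l_def)
    \<comment> \<open>Once the common q-factorials are cancelled, Pascal's rule is this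
      identity.\<close>
    have "1 - q ^ (k + l + 2) = (1 - q ^ Suc l) + q ^ Suc l * (1 - q ^ Suc k)"
      by (simp add: algebra_simps power_add power2_eq_square)
    moreover have "nat (n + 1) = Suc (Suc (k + l))" "nat n = Suc (k + l)" "nat r = Suc k"
      "nat (n + 1 - r) = Suc l" "nat (n - r) = l" "nat (r - 1) = k" "nat (n - (r - 1)) = Suc l"
      using r n by auto
    moreover have "q powi (n + 1 - r) = q ^ Suc l"
      using r n by (simp add: power_int_def nat_add_distrib)
    ultimately show ?thesis
      using 4 qfac_nonzero[of k] qfac_nonzero[of l] q_power_neq_1[of "Suc k"] q_power_neq_1[of "Suc l"]
      by (simp add: qbinom_def qfac_Suc[of q "Suc (k+l)"] qfac_Suc[of q k] qfac_Suc[of q l] divide_simps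
        del: power_Suc) (simp add: algebra_simps power_add)
  qed
qed

text \<open>Both sides are the q-trinomial coefficient with parts k, s and n - k - s, and both
  vanish if a part is negative.\<close>

lemma qbinom_mult: "qbinom q n k * qbinom q (n - k) s = qbinom q n (k + s) * qbinom q (k + s) k"
proof -
  consider "k < 0" | "s < 0" | "n < k + s" | "0 \<le> k" "0 \<le> s" "k + s \<le> n" by linarith
  then show ?thesis
  proof cases
    case 4
    then show ?thesis using qfac_nonzero by (auto simp: qbinom_def algebra_simps)
  qed (auto simp: qbinom_eq_0)
qed

text \<open>Induction on m by Pascal's rule. Terms outside \<open>{0..n}\<close> vanish, so any
  larger finite range is allowed, which makes shifts of s painless.\<close>

lemma q_vandermonde:
  assumes "0 \<le> n" "0 \<le> m" "finite S" "{0..n} \<subseteq> S"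
  shows "(\<Sum>s\<in>S. q powi ((n - s) * (r - s)) * qbinom q n s * qbinom q m (r - s)) = qbinom q (m + n) r"
    (is "sum (?f m r) S = _")
proof -
  have "sum (?f m r) {0..n} = qbinom q (m + n) r" if "0 \<le> m" for m r
    using that
  proof (induction m arbitrary: r rule: int_ge_induct)
    case base
    have "sum (?f 0 r) {0..n} = sum (?f 0 r) ({0..n} \<inter> {r})"
      by (rule sum.mono_neutral_right) (auto simp: qbinom_def)
    also have "\<dots> = qbinom q n r"
      by (cases "r \<in> {0..n}") (auto simp: qbinom_0_right qbinom_eq_0)
    finally show ?case by simp
  next
    case (step m)
    have "?f (m + 1) r s = ?f m r s + q powi (m + n + 1 - r) * ?f m (r - 1) s" for s
    proof -
      \<comment> \<open>The power of q from Pascal's rule splits into a part free of s and the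
        change from r to r - 1.\<close>
      have "(n - s) * (r - s) + (m + 1 - (r - s)) = (m + n + 1 - r) + (n - s) * (r - 1 - s)"
        by (simp add: algebra_simps)
      then have "q powi ((n - s) * (r - s)) * q powi (m + 1 - (r - s))
        = q powi (m + n + 1 - r) * q powi ((n - s) * (r - 1 - s))"
        by (simp only: powi_mult_powi)
      moreover have "r - s - 1 = r - 1 - s" by simp
      ultimately show ?thesis using qbinom_pascal[OF step(1), of "r - s"] by (simp add: algebra_simps)
    qed
    then have "sum (?f (m + 1) r) {0..n}
      = sum (?f m r) {0..n} + q powi (m + n + 1 - r) * sum (?f m (r - 1)) {0..n}"
      by (simp add: sum.distrib sum_distrib_left)
    then show ?case
      using step.IH[of r] step.IH[of "r - 1"] qbinom_pascal[of "m + n" r] step(1) assms(1)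
      by (simp add: algebra_simps)
  qed
  moreover have "sum (?f m r) {0..n} = sum (?f m r) S"
    by (rule sum.mono_neutral_left) (use assms in \<open>auto simp: qbinom_eq_0\<close>)
  ultimately show ?thesis using assms by simp
qed

lemma q_vandermonde_offset:
  assumes "0 \<le> n" "0 \<le> m" "finite S" "{0..n} \<subseteq> S"
  shows "(\<Sum>s\<in>S. q powi (s * (s + c)) * qbinom q n s * qbinom q m (s + c)) = qbinom q (m + n) (n + c)"
    (is "sum ?f S = _")
proof -
  have "sum ?f S = sum ?f {0..n}"
    by (rule sum.mono_neutral_right) (use assms in \<open>auto simp: qbinom_eq_0\<close>)
  also have "\<dots> = (\<Sum>s\<in>{0..n}. q powi ((n - s) * (n + c - s)) * qbinom q n s * qbinom q m (n + c - s))"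
    by (rule sum.reindex_bij_witness[of _ "\<lambda>s. n - s" "\<lambda>s. n - s"])
      (auto simp: qbinom_symmetric algebra_simps)
  also have "\<dots> = qbinom q (m + n) (n + c)" by (rule q_vandermonde) (use assms in auto)
  finally show ?thesis .
qed

text \<open>
  Expanding the last factor by \<open>q_vandermonde\<close> with an exponent that does not involve \<open>k\<close> makes the
  sum over \<open>k\<close>, and then the sum over \<open>t\<close>, again of Vandermonde type.
\<close>

lemma q_saalschuetz:
  assumes "0 \<le> A" "0 \<le> B" "0 \<le> N" "0 \<le> c"
  shows "(\<Sum>k=0..A. q powi (k * (k + c)) * qbinom q A k * qbinom q B (k + c)
           * qbinom q (A + B + N - k) (N - k))
         = qbinom q (A + N + c) N * qbinom q (B + N) (N + c)"
proof -
  have split: "qbinom q (A + B + N - k) (N - k)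
      = (\<Sum>t=0..A. q powi ((A - t) * (N - t)) * qbinom q (A - k) (t - k) * qbinom q (B + N) (N - t))"
    if "k \<in> {0..A}" for k
  proof -
    have "(\<Sum>t=0..A. q powi ((A - t) * (N - t)) * qbinom q (A - k) (t - k) * qbinom q (B + N) (N - t))
      = (\<Sum>s=-k..A-k. q powi ((A - k - s) * (N - k - s)) * qbinom q (A - k) s
           * qbinom q (B + N) (N - k - s))"
      by (rule sum.reindex_bij_witness[of _ "\<lambda>s. s + k" "\<lambda>t. t - k"]) auto
    also have "\<dots> = qbinom q ((B + N) + (A - k)) (N - k)"
      by (rule q_vandermonde) (use that assms in auto)
    finally show ?thesis by (simp add: algebra_simps)
  qed
  have mult: "qbinom q A k * qbinom q (A - k) (t - k) = qbinom q A t * qbinom q t k" for k t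
    using qbinom_mult[of A k "t - k"] by simp
  have "(\<Sum>k=0..A. q powi (k * (k + c)) * qbinom q A k * qbinom q B (k + c)
           * qbinom q (A + B + N - k) (N - k))
    = (\<Sum>k=0..A. \<Sum>t=0..A. q powi (k * (k + c)) * qbinom q A k * qbinom q B (k + c)
        * (q powi ((A - t) * (N - t)) * qbinom q (A - k) (t - k) * qbinom q (B + N) (N - t)))"
    by (intro sum.cong refl) (simp add: split sum_distrib_left)
  also have "\<dots> = (\<Sum>k=0..A. \<Sum>t=0..A. q powi ((A - t) * (N - t)) * qbinom q A t * qbinom q (B + N) (N - t)
        * (q powi (k * (k + c)) * qbinom q t k * qbinom q B (k + c)))"
  proof (intro sum.cong refl)
    fix k t
    have "x * qbinom q A k * y * (z * qbinom q (A - k) (t - k) * w)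
        = z * qbinom q A t * w * (x * qbinom q t k * y)" for x y z w
      using mult[of k t] by algebra
    then show "q powi (k * (k + c)) * qbinom q A k * qbinom q B (k + c)
        * (q powi ((A - t) * (N - t)) * qbinom q (A - k) (t - k) * qbinom q (B + N) (N - t))
      = q powi ((A - t) * (N - t)) * qbinom q A t * qbinom q (B + N) (N - t)
        * (q powi (k * (k + c)) * qbinom q t k * qbinom q B (k + c))" .
  qed
  also have "\<dots> = (\<Sum>t=0..A. q powi ((A - t) * (N - t)) * qbinom q A t * qbinom q (B + N) (N - t)
        * (\<Sum>k=0..A. q powi (k * (k + c)) * qbinom q t k * qbinom q B (k + c)))"
    by (subst sum.swap) (simp add: sum_distrib_left)
  also have "\<dots> = (\<Sum>t=0..A. q powi ((A - t) * (N - t)) * qbinom q A t * qbinom q (N + c) (N - t)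
        * qbinom q (B + N) (N + c))"
  proof (intro sum.cong refl)
    fix t assume t: "t \<in> {0..A}"
    have "(\<Sum>k=0..A. q powi (k * (k + c)) * qbinom q t k * qbinom q B (k + c)) = qbinom q (B + t) (t + c)"
      by (rule q_vandermonde_offset) (use assms t in auto)
    \<comment> \<open>The lower entries N - t and t + c add up to N + c, so a factor free of t can
      leave the sum.\<close>
    moreover have "qbinom q (B + N) (N - t) * qbinom q (B + t) (t + c)
        = qbinom q (N + c) (N - t) * qbinom q (B + N) (N + c)"
      using qbinom_mult[of "B + N" "N - t" "t + c"] by (simp add: algebra_simps)
    ultimately show "q powi ((A - t) * (N - t)) * qbinom q A t * qbinom q (B + N) (N - t)
        * (\<Sum>k=0..A. q powi (k * (k + c)) * qbinom q t k * qbinom q B (k + c))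
      = q powi ((A - t) * (N - t)) * qbinom q A t * qbinom q (N + c) (N - t) * qbinom q (B + N) (N + c)"
      by (simp add: mult.assoc)
  qed
  also have "\<dots> = (\<Sum>t\<in>{0..A}. q powi ((A - t) * (N - t)) * qbinom q A t * qbinom q (N + c) (N - t))
        * qbinom q (B + N) (N + c)"
    by (simp add: sum_distrib_right)
  also have "\<dots> = qbinom q (A + N + c) N * qbinom q (B + N) (N + c)"
    by (subst q_vandermonde) (use assms in \<open>auto simp: algebra_simps\<close>)
  finally show ?thesis .
qed

text \<open>This is \<open>q_saalschuetz\<close> with summation variable i - b and offset 2b. Unless
  a + b \<le> L and b \<le> M, every term on either side is 0.\<close>

lemma burge_nonneg:
  assumes "0 \<le> a" "0 \<le> b" "0 \<le> L" "0 \<le> M"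
  shows "(\<Sum>i=0..L. q powi (i * i) * qbinom q (2 * L + M - i) (2 * L) * Bq q (L - i) i a b)
         = q powi (b * b) * Bq q L M (a + b) b" (is "sum ?f _ = _")
proof (cases "a + b \<le> L \<and> b \<le> M")
  case False
  have vanish: "?f i = 0" if "i \<in> {0..L}" for i
  proof (cases "b \<le> i \<and> a \<le> L - i")
    case True
    with False have "M < i" by auto
    then show ?thesis by (simp add: qbinom_eq_0)
  next
    case False
    then have "Bq q (L - i) i a b = 0" using assms by (intro Bq_eq_0) auto
    then show ?thesis by simp
  qed
  have "Bq q L M (a + b) b = 0"
    using False assms by (intro Bq_eq_0) auto
  moreover have "sum ?f {0..L} = 0" using vanish by (intro sum.neutral ballI)
  ultimately show ?thesis by simp
next
  case True
  define A B N where "A = L + a - b" and "B = L - a + b" and "N = M - b"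
  have nonneg: "0 \<le> A" "0 \<le> B" "0 \<le> N" using True assms by (auto simp: A_def B_def N_def)
  have summand: "?f i = q powi (b * b) * (q powi ((i - b) * (i - b + 2 * b)) * qbinom q A (i - b)
      * qbinom q B (i - b + 2 * b) * qbinom q (A + B + N - (i - b)) (N - (i - b)))" for i
  proof -
    have "q powi (i * i) = q powi (b * b) * q powi ((i - b) * (i - b + 2 * b))"
      by (simp add: powi_mult_powi algebra_simps)
    moreover have "qbinom q (2 * L + M - i) (2 * L) = qbinom q (A + B + N - (i - b)) (N - (i - b))"
      using qbinom_symmetric[of q "2 * L + M - i" "2 * L"]
      by (simp add: A_def B_def N_def algebra_simps)
    moreover have "Bq q (L - i) i a b = qbinom q A (i - b) * qbinom q B (i - b + 2 * b)"
      using qbinom_symmetric[of q A "i - b"] qbinom_symmetric[of q B "i + b"]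
      by (simp add: Bq_def A_def B_def algebra_simps)
    ultimately show ?thesis by (simp add: mult_ac)
  qed
  have "sum ?f {0..L} = sum ?f {b..b + A}"
    by (rule sum.mono_neutral_cong)
      (use True assms in \<open>auto intro!: Bq_eq_0 simp: A_def summand qbinom_eq_0 B_def\<close>)
  also have "\<dots> = (\<Sum>k=0..A. q powi (b * b) * (q powi (k * (k + 2 * b)) * qbinom q A k
      * qbinom q B (k + 2 * b) * qbinom q (A + B + N - k) (N - k)))"
    unfolding summand by (rule sum.reindex_bij_witness[of _ "\<lambda>k. k + b" "\<lambda>i. i - b"]) auto
  also have "\<dots> = q powi (b * b) * (qbinom q (A + N + 2 * b) N * qbinom q (B + N) (N + 2 * b))"
    using q_saalschuetz[of A B N "2 * b"] nonneg assms by (simp flip: sum_distrib_left)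
  also have "\<dots> = q powi (b * b) * Bq q L M (a + b) b"
    using qbinom_symmetric[of q "A + N + 2 * b" N] qbinom_symmetric[of q "B + N" "N + 2 * b"]
    by (simp add: Bq_def A_def B_def N_def algebra_simps)
  finally show ?thesis .
qed

text \<open>Negating both parameters changes nothing, so only their signs relative to each other
  matter; they will be aj and bj with j of either sign.\<close>

lemma burge:
  assumes "0 \<le> a * b" "0 \<le> L" "0 \<le> M"
  shows "(\<Sum>i=0..L. q powi (i * i) * qbinom q (2 * L + M - i) (2 * L) * Bq q (L - i) i a b)
         = q powi (b * b) * Bq q L M (a + b) b"
proof (cases "0 \<le> a \<and> 0 \<le> b")
  case True
  then show ?thesis using burge_nonneg assms by blast
next
  case False
  with assms(1) have "0 \<le> - a" "0 \<le> - b" by (auto simp: zero_le_mult_iff)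
  from burge_nonneg[OF this assms(2,3)] show ?thesis
    using Bq_uminus[of q L M "a + b" b] by (simp add: Bq_uminus)
qed

lemma burge_low:
  assumes "0 \<le> a * b"
  shows "(\<Sum>i\<le>L. q powi (int i * int i) * qbinom q (2 * int L + int M - int i) (2 * int L)
            * Bq q (int i) (int (L - i)) a b)
         = q powi (a * a) * Bq q (int L) (int M) (a + b) a"
proof -
  have "(\<Sum>i\<le>L. q powi (int i * int i) * qbinom q (2 * int L + int M - int i) (2 * int L)
            * Bq q (int i) (int (L - i)) a b)
    = (\<Sum>i=0..int L. q powi (i * i) * qbinom q (2 * int L + int M - i) (2 * int L)
            * Bq q (int L - i) i b a)"
    by (rule sum.reindex_bij_witness[of _ nat int])
      (auto simp: Bq_swap[of q _ _ b a] of_nat_diff)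
  also have "\<dots> = q powi (a * a) * Bq q (int L) (int M) (a + b) a"
    using burge[of b a "int L" "int M"] assms by (simp add: mult.commute add.commute)
  finally show ?thesis .
qed

text \<open>Reverse the summation by i to L - i and use (L - i)^2 = L(L - 2i) + i^2.\<close>

lemma burge_high:
  assumes "0 \<le> a * b"
  shows "(\<Sum>i\<le>L. q powi (int L * (int L - 2 * int i)) * q powi (int i * int i)
            * qbinom q (int L + int M + int i) (2 * int L) * Bq q (int i) (int (L - i)) a b)
         = q powi (b * b) * Bq q (int L) (int M) (a + b) b"
proof -
  have "(\<Sum>i\<le>L. q powi (int L * (int L - 2 * int i)) * q powi (int i * int i)
            * qbinom q (int L + int M + int i) (2 * int L) * Bq q (int i) (int (L - i)) a b)
    = (\<Sum>i=0..int L. q powi (i * i) * qbinom q (2 * int L + int M - i) (2 * int L)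
            * Bq q (int L - i) i a b)"
    by (rule sum.reindex_bij_witness[of _ "\<lambda>i. L - nat i" "\<lambda>i. int (L - i)"])
      (auto simp: of_nat_diff powi_mult_powi algebra_simps)
  also have "\<dots> = q powi (b * b) * Bq q (int L) (int M) (a + b) b"
    using burge[OF assms] by simp
  finally show ?thesis .
qed

section \<open>The q-binomial theorem and the identity at the root (1, 1)\<close>

lemma q_binomial_theorem:
  assumes "x \<noteq> 0"
  shows "(\<Sum>k=0..int n. (-1) powi k * q powi (k * (k - 1) div 2) * qbinom q (int n) k * x powi k)
         = qpoch q x n"
proof (induction n)
  case 0
  then show ?case by (simp add: qbinom_self qpoch_def)
next
  case (Suc n)
  let ?f = "\<lambda>n k. (-1) powi k * q powi (k * (k - 1) div 2) * qbinom q n k * x powi k"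
  have summand: "?f (int n + 1) k = ?f (int n) k - x * q ^ n * ?f (int n) (k - 1)" for k
  proof -
    have "k * (k - 1) = (k - 1) * (k - 1 - 1) + (k - 1) * 2" by (simp add: algebra_simps)
    then have "k * (k - 1) div 2 = (k - 1) * (k - 1 - 1) div 2 + (k - 1)" by simp
    then have "q powi (k * (k - 1) div 2) * q powi (int n + 1 - k)
        = q powi ((k - 1) * (k - 1 - 1) div 2) * q ^ n"
      by (simp add: powi_mult_powi flip: power_int_of_nat)
    moreover have "x powi k = x powi (k - 1) * x"
      using assms power_int_add_1[of x "k - 1"] by simp
    moreover have "(-1 :: 'a) powi k = - ((-1) powi (k - 1))"
      using power_int_add_1[of "-1 :: 'a" "k - 1"] by simp
    moreover have "qbinom q (int n + 1) k = qbinom q (int n) k + q powi (int n + 1 - k) * qbinom q (int n) (k - 1)"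
      by (rule qbinom_pascal) simp
    moreover have "- e' * p * (B + r * C) * (y * x) = - e' * p * B * (y * x) - x * z * (e' * p' * C * y)"
      if "p * r = p' * z" for e' p B r C y p' z :: 'a
      using that by algebra
    ultimately show ?thesis by simp
  qed
  have "sum (?f (int (Suc n))) {0..int (Suc n)} = (\<Sum>k=0..int n + 1. ?f (int n + 1) k)"
    by (simp add: add.commute)
  also have "\<dots> = sum (?f (int n)) {0..int n + 1} - x * q ^ n * (\<Sum>k=0..int n + 1. ?f (int n) (k - 1))"
    unfolding summand by (simp add: sum_subtractf sum_distrib_left)
  also have "sum (?f (int n)) {0..int n + 1} = sum (?f (int n)) {0..int n}"
    by (rule sum.mono_neutral_right) (auto simp: qbinom_eq_0)
  also have "(\<Sum>k=0..int n + 1. ?f (int n) (k - 1)) = sum (?f (int n)) {-1..int n}"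
    by (rule sum.reindex_bij_witness[of _ "\<lambda>k. k + 1" "\<lambda>k. k - 1"]) auto
  also have "\<dots> = sum (?f (int n)) {0..int n}"
    by (rule sum.mono_neutral_right) (auto simp: qbinom_eq_0)
  finally show ?case using Suc.IH by (simp add: qpoch_def algebra_simps)
qed

text \<open>For r > 0 the substitution k = r - j gives the q-binomial theorem at x = q^(-r), whose
  product contains the factor 1 - q^(-r) q^r = 0.\<close>

lemma alternating_sum_central_qbinom:
  assumes "r \<le> int K"
  shows "(\<Sum>j=- int K..int K. (-1) powi j * q powi (j * (j + 1) div 2) * qbinom q (2 * r) (r + j))
         = (if r = 0 then 1 else 0)" (is "sum ?f _ = _")
proof (cases "0 < r")
  case False
  show ?thesis
  proof (cases "r = 0")
    case True
    have "sum ?f {- int K..int K} = sum ?f {0}"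
      by (rule sum.mono_neutral_right) (auto simp: True qbinom_def)
    then show ?thesis using True by (simp add: qbinom_self)
  next
    case False
    with \<open>\<not> 0 < r\<close> have "qbinom q (2 * r) (r + j) = 0" for j
      by (cases "r + j < 0") (auto intro: qbinom_eq_0)
    with False show ?thesis by simp
  qed
next
  case True
  define n where "n = nat (2 * r)"
  have n: "int n = 2 * r" using True by (simp add: n_def)
  have "sum ?f {- int K..int K} = sum ?f {-r..r}"
    by (rule sum.mono_neutral_right) (use assms in \<open>auto simp: qbinom_eq_0\<close>)
  also have "\<dots> = (\<Sum>k=0..int n. (-1) powi r * q powi (r * (r + 1) div 2) *
      ((-1) powi k * q powi (k * (k - 1) div 2) * qbinom q (int n) k * (q powi - r) powi k))"
  proof (rule sum.reindex_bij_witness[of _ "\<lambda>k. r - k" "\<lambda>j. r - j"])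
    fix j assume "j \<in> {-r..r}"
    define k where "k = r - j"
    \<comment> \<open>Products of consecutive integers are even, so the halves are exact and can be
      added.\<close>
    have "r * (r + 1) = 2 * (r * (r + 1) div 2)" "k * (k - 1) = 2 * (k * (k - 1) div 2)"
      "j * (j + 1) = 2 * (j * (j + 1) div 2)"
      by (simp_all)
    moreover have "j * (j + 1) = r * (r + 1) + k * (k - 1) - 2 * (r * k)"
      by (simp add: k_def algebra_simps)
    ultimately have "j * (j + 1) div 2 = r * (r + 1) div 2 + k * (k - 1) div 2 + - r * k" by linarith
    then have "q powi (j * (j + 1) div 2)
        = q powi (r * (r + 1) div 2) * q powi (k * (k - 1) div 2) * (q powi - r) powi k"
      by (simp only: powi_mult_powi flip: power_int_mult)
    moreover have "(-1 :: 'a) powi j = (-1) powi r * (-1) powi k"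
      using power_int_add[of "-1 :: 'a" r "- k"]
      by (simp add: k_def power_int_minus_one_diff_commute[of r j])
    moreover have "qbinom q (int n) k = qbinom q (2 * r) (r + j)"
      using qbinom_symmetric[of q "2 * r" k] by (simp add: n k_def algebra_simps)
    ultimately show "(-1) powi r * q powi (r * (r + 1) div 2) *
      ((-1) powi (r - j) * q powi ((r - j) * (r - j - 1) div 2) * qbinom q (int n) (r - j)
        * (q powi - r) powi (r - j)) = ?f j"
      by (simp add: k_def mult_ac)
  qed (use n in auto)
  also have "\<dots> = (-1) powi r * q powi (r * (r + 1) div 2) * qpoch q (q powi - r) n"
    using q_binomial_theorem[of "q powi - r" n] q_nonzero
    by (simp flip: sum_distrib_left)
  also have "qpoch q (q powi - r) n = 0"
  proof -
    have "q powi - r * q ^ nat r = 1"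
      using True q_nonzero by (simp add: power_int_def power_inverse)
    moreover have "nat r < n" using True n by linarith
    ultimately show ?thesis by (auto simp: qpoch_def)
  qed
  finally show ?thesis using True by simp
qed

text \<open>A Vandermonde expansion arranged so that j survives only in a central binomial; the
  alternating sum over j can then be carried out first.\<close>

lemma Bq_diag_expand:
  fixes L M :: nat
  shows "q powi (j * j) * Bq q (int L) (int M) j j
    = (\<Sum>r=-(int L + int M)..int L + int M. q powi (r * r) * qbinom q (int L + int M) (int L - r)
        * qbinom q (int M + r) (2 * r) * qbinom q (2 * r) (r + j))"
proof -
  define N where "N = int L + int M"
  have summand: "qbinom q N (int L - r) * qbinom q (int M + r) (2 * r) * qbinom q (2 * r) (r + j)
      = qbinom q N (int L + j) * qbinom q (int M - j) (r - j) * qbinom q (int L + j) (r + j)" for r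
  proof -
    have "qbinom q N (int L - r) * qbinom q (int M + r) (r + j)
        = qbinom q N (int L + j) * qbinom q (int L + j) (r + j)"
      using qbinom_mult[of N "int L - r" "r + j"] qbinom_symmetric[of q "int L + j" "r + j"]
      by (simp add: N_def algebra_simps)
    moreover have "qbinom q (int M + r) (2 * r) * qbinom q (2 * r) (r + j)
        = qbinom q (int M + r) (r + j) * qbinom q (int M - j) (r - j)"
      using qbinom_mult[of "int M + r" "r + j" "r - j"] by (simp add: algebra_simps)
    ultimately show ?thesis by algebra
  qed
  show ?thesis
  proof (cases "0 \<le> int L + j \<and> 0 \<le> int M - j")
    case False
    then have "qbinom q N (int L + j) = 0" by (intro qbinom_eq_0) (auto simp: N_def)
    then have "Bq q (int L) (int M) j j = 0"
      and "qbinom q N (int L - r) * qbinom q (int M + r) (2 * r) * qbinom q (2 * r) (r + j) = 0" for r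
      by (simp_all only: summand mult_zero_left) (simp add: Bq_def N_def)
    then show ?thesis
      by (simp only: mult.assoc flip: N_def) simp
  next
    case True
    have "(\<Sum>r=-N..N. q powi (r * r) * (qbinom q N (int L - r) * qbinom q (int M + r) (2 * r)
          * qbinom q (2 * r) (r + j)))
      = (\<Sum>s=-N-j..N-j. q powi (j * j) * qbinom q N (int L + j) *
          (q powi (s * (s + 2 * j)) * qbinom q (int M - j) s * qbinom q (int L + j) (s + 2 * j)))"
      unfolding summand
    proof (rule sum.reindex_bij_witness[of _ "\<lambda>s. s + j" "\<lambda>r. r - j"])
      fix r
      have "r * r = j * j + (r - j) * (r - j + 2 * j)" by (simp add: algebra_simps)
      then have "q powi (r * r) = q powi (j * j) * q powi ((r - j) * (r - j + 2 * j))"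
        by (simp only: powi_mult_powi)
      moreover have "r - j + 2 * j = r + j" by simp
      ultimately show "q powi (j * j) * qbinom q N (int L + j) * (q powi ((r - j) * (r - j + 2 * j))
          * qbinom q (int M - j) (r - j) * qbinom q (int L + j) (r - j + 2 * j))
        = q powi (r * r) * (qbinom q N (int L + j) * qbinom q (int M - j) (r - j)
          * qbinom q (int L + j) (r + j))"
        by (simp only: mult_ac)
    qed auto
    also have "\<dots> = q powi (j * j) * qbinom q N (int L + j) * qbinom q N (int M + j)"
    proof -
      have "(\<Sum>s=-N-j..N-j. q powi (s * (s + 2 * j)) * qbinom q (int M - j) s * qbinom q (int L + j) (s + 2 * j))
        = qbinom q (int L + j + (int M - j)) (int M - j + 2 * j)"
        by (rule q_vandermonde_offset) (use True in \<open>auto simp: N_def\<close>)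
      also have "\<dots> = qbinom q N (int M + j)" by (simp add: N_def add.commute)
      finally show ?thesis by (simp only: flip: sum_distrib_left)
    qed
    also have "qbinom q N (int M + j) = qbinom q N (int L - j)"
      using qbinom_symmetric[of q N "int L - j"] by (simp add: N_def algebra_simps)
    finally have "(\<Sum>r=-N..N. q powi (r * r) * (qbinom q N (int L - r) * qbinom q (int M + r) (2 * r)
          * qbinom q (2 * r) (r + j)))
        = q powi (j * j) * Bq q (int L) (int M) j j" by (simp add: N_def Bq_def mult.assoc)
    then show ?thesis by (simp only: mult.assoc flip: N_def)
  qed
qed

lemma alternating_sum_Bq_diag:
  fixes L M :: nat
  shows "(\<Sum>j=- int L..int L. (-1) powi j * q powi (j * (3 * j + 1) div 2) * Bq q (int L) (int M) j j)
    = qbinom q (int L + int M) (int L)"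
proof -
  define N where "N = int L + int M"
  define w where "w r = q powi (r * r) * qbinom q N (int L - r) * qbinom q (int M + r) (2 * r)" for r
  have "(-1) powi j * q powi (j * (3 * j + 1) div 2) * Bq q (int L) (int M) j j
    = (\<Sum>r=-N..N. w r * ((-1) powi j * q powi (j * (j + 1) div 2) * qbinom q (2 * r) (r + j)))" for j
  proof -
    have "j * (3 * j + 1) = j * (j + 1) + (j * j) * 2" by (simp add: algebra_simps)
    then have "j * (3 * j + 1) div 2 = j * (j + 1) div 2 + j * j" by simp
    then have "(-1) powi j * q powi (j * (3 * j + 1) div 2) * Bq q (int L) (int M) j j
      = (-1) powi j * q powi (j * (j + 1) div 2) * (q powi (j * j) * Bq q (int L) (int M) j j)"
      by (simp add: mult_ac flip: powi_mult_powi)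
    then show ?thesis
      unfolding Bq_diag_expand by (simp add: sum_distrib_left N_def w_def mult_ac)
  qed
  then have "(\<Sum>j=- int L..int L. (-1) powi j * q powi (j * (3 * j + 1) div 2) * Bq q (int L) (int M) j j)
    = (\<Sum>r=-N..N. w r * (\<Sum>j=- int L..int L. (-1) powi j * q powi (j * (j + 1) div 2) * qbinom q (2 * r) (r + j)))"
    by (simp add: sum_distrib_left sum.swap[of _ "{- int L..int L}"])
  also have "\<dots> = (\<Sum>r\<in>{-N..N}. if r = 0 then w r else 0)"
  proof (intro sum.cong refl)
    fix r
    show "w r * (\<Sum>j=- int L..int L. (-1) powi j * q powi (j * (j + 1) div 2) * qbinom q (2 * r) (r + j))
      = (if r = 0 then w r else 0)"
      \<comment> \<open>For r > L the range of j is too short for the lemma, but then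
        \<open>w r = 0\<close>.\<close>
      using alternating_sum_central_qbinom[of r L]
      by (cases "r \<le> int L") (auto simp: w_def qbinom_eq_0)
  qed
  also have "\<dots> = w 0" by (simp add: N_def)
  also have "\<dots> = qbinom q N (int L)" by (simp add: w_def qbinom_0_right)
  finally show ?thesis by (simp add: N_def)
qed

end

section \<open>The recursion for the sum over \<open>m\<close>\<close>

text \<open>
  \<open>cf_row T m j\<close> is the \<open>j\<close>-th entry of \<open>C m\<close>, for vectors \<open>m\<close> with support in \<open>{1..d}\<close>; at \<open>j = 1\<close> it
  relies on \<open>m 0 = 0\<close>. The set \<open>T\<close> stands for \<open>{t\<^sub>1, \<dots>, t\<^sub>n\<^sub>+\<^sub>1}\<close>.
\<close>

definition cf_row :: "nat set \<Rightarrow> (nat \<Rightarrow> nat) \<Rightarrow> nat \<Rightarrow> int" where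
  "cf_row T m j = (if j \<in> T then int (m j) - int (m (j - 1)) + int (m (j + 1))
                   else 2 * int (m j) - int (m (j - 1)) - int (m (j + 1)))"

definition cf_quad :: "nat set \<Rightarrow> nat \<Rightarrow> (nat \<Rightarrow> nat) \<Rightarrow> int" where
  "cf_quad T d m = (\<Sum>j\<in>{1..d}. int (m j) * cf_row T m j)"

definition cf_prod :: "'a::field \<Rightarrow> nat set \<Rightarrow> nat \<Rightarrow> nat \<Rightarrow> (nat \<Rightarrow> nat) \<Rightarrow> 'a" where
  "cf_prod q T d L m = (\<Prod>j\<in>{1..d}.
     qbinom q ((if j < d then 2 else 1) * int (m j) + (int L * dlt (j = 1) - cf_row T m j))
       ((if j < d then 2 else 1) * int (m j)))"

text \<open>The bound L makes the set finite; \<open>cf_prod_nonzero_imp_vecs\<close> shows that no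
  nonzero term is lost.\<close>

definition vecs :: "nat \<Rightarrow> nat \<Rightarrow> (nat \<Rightarrow> nat) set" where
  "vecs d L = {m. (\<forall>k. k \<notin> {1..d} \<longrightarrow> m k = 0) \<and> (\<forall>k. m k \<le> L)}"

text \<open>The flag \<open>low\<close> selects the form of F for a \<le> 2b. It is a free parameter
  because both forms are used at a = 2b.\<close>

definition cf_weight :: "'a::field \<Rightarrow> bool \<Rightarrow> nat \<Rightarrow> nat \<Rightarrow> nat \<Rightarrow> 'a" where
  "cf_weight q low L M i =
     (if low then qbinom q (2 * int L + int M - int i) (2 * int L)
      else q powi (int L * (int L - 2 * int i)) * qbinom q (int L + int M + int i) (2 * int L))"

definition cf_sum :: "'a::field \<Rightarrow> bool \<Rightarrow> nat set \<Rightarrow> nat \<Rightarrow> nat \<Rightarrow> nat \<Rightarrow> 'a" where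
  "cf_sum q low T d L M =
     (\<Sum>m\<in>vecs d L. cf_weight q low L M (m 1) * (q powi cf_quad T d m * cf_prod q T d L m))"

lemma finite_vecs: "finite (vecs d L)"
  by (rule finite_subset[OF _ finite_set_of_finite_funs[of "{1..d}" "{..L}" 0]]) (auto simp: vecs_def)

text \<open>
  A nonzero product forces \<open>n\<^sub>j \<ge> 0\<close> for all \<open>j\<close>, and this makes \<open>L, m\<^sub>1, m\<^sub>2, \<dots>\<close> decreasing.
\<close>

lemma cf_prod_nonzero_imp_vecs:
  assumes supp: "\<forall>k. k \<notin> {1..d} \<longrightarrow> m k = 0" and "cf_prod q T d L m \<noteq> 0"
  shows "m \<in> vecs d L"
proof -
  \<comment> \<open>With L in place of the zeroth entry, the inequality for row 1 has the shape of
    all others.\<close>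
  define p where "p j = (if j = 0 then L else m j)" for j
  have row: "cf_row T m j \<le> int L * dlt (j = 1)" if "j \<in> {1..d}" for j
  proof (rule ccontr)
    assume "\<not> ?thesis"
    then have "qbinom q ((if j < d then 2 else 1) * int (m j) + (int L * dlt (j = 1) - cf_row T m j))
       ((if j < d then 2 else 1) * int (m j)) = 0" by (intro qbinom_eq_0) auto
    then have "cf_prod q T d L m = 0"
      unfolding cf_prod_def by (intro prod_zero bexI[OF _ that]) simp_all
    with assms show False by simp
  qed
  have "m 0 = 0" using supp by simp
  \<comment> \<open>Downward from j = d: a row outside T bounds twice an entry by the sum of its
    neighbours, so it needs the inequality one index higher; a row in T gives the claim at
    once.\<close>
  have mono: "p (Suc j) \<le> p j" if "j \<le> d" for j
    using that
  proof (induction j rule: inc_induct)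
    case base
    then show ?case using supp by (simp add: p_def)
  next
    case (step n)
    have "cf_row T m (Suc n) \<le> int L * dlt (Suc n = 1)" using step by (intro row) auto
    with step.IH \<open>m 0 = 0\<close> show ?case
      by (cases "n = 0") (auto simp: p_def cf_row_def dlt_def split: if_splits)
  qed
  have le: "p j \<le> L" if "j \<le> Suc d" for j
    using that
  proof (induction j)
    case (Suc j)
    then show ?case using mono[of j] by simp
  qed (simp add: p_def)
  have "m k \<le> L" for k
    using supp le[of k] by (cases "k \<in> {1..d}") (auto simp: p_def)
  with supp show ?thesis by (auto simp: vecs_def)
qed

section \<open>The matrix C expressed by \<open>cf_row\<close>\<close>

lemma sum_dlt:
  fixes m :: "nat \<Rightarrow> nat"
  assumes "\<forall>k. k \<notin> {1..d} \<longrightarrow> m k = 0"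
  shows "(\<Sum>k\<in>{1..d}. dlt (k = i) * int (m k)) = int (m i)"
proof -
  have "(\<Sum>k\<in>{1..d}. dlt (k = i) * int (m k)) = (\<Sum>k\<in>{1..d}. if k = i then int (m k) else 0)"
    by (intro sum.cong) (auto simp: dlt_def)
  then show ?thesis using assms by (auto simp: sum.delta)
qed

lemma sum_Cmat:
  fixes m :: "nat \<Rightarrow> nat"
  assumes supp: "\<forall>k. k \<notin> {1..dab a b} \<longrightarrow> m k = 0" and "1 \<le> j"
  shows "(\<Sum>k\<in>{1..dab a b}. Cmat a b j k * int (m k)) = cf_row (Tset a b) m j"
proof -
  let ?S = "\<lambda>i. \<Sum>k\<in>{1..dab a b}. dlt (k = i) * int (m k)"
  have "Cmat a b j k * int (m k) = (if j \<in> Tset a b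
      then dlt (k = j) * int (m k) - dlt (k = j - 1) * int (m k) + dlt (k = j + 1) * int (m k)
      else 2 * (dlt (k = j) * int (m k)) - dlt (k = j - 1) * int (m k) - dlt (k = j + 1) * int (m k))" for k
    using assms by (auto simp: Cmat_def Imat_def dlt_def)
  then have "(\<Sum>k\<in>{1..dab a b}. Cmat a b j k * int (m k))
    = (if j \<in> Tset a b then ?S j - ?S (j - 1) + ?S (j + 1) else 2 * ?S j - ?S (j - 1) - ?S (j + 1))"
    by (simp add: sum.distrib sum_subtractf sum_distrib_left)
  then show ?thesis unfolding sum_dlt[OF supp] by (simp add: cf_row_def)
qed

lemma quadC_eq:
  assumes supp: "\<forall>k. k \<notin> {1..dab a b} \<longrightarrow> m k = 0"
  shows "quadC a b m = cf_quad (Tset a b) (dab a b) m"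
proof -
  have "quadC a b m = (\<Sum>j\<in>{1..dab a b}. int (m j) * (\<Sum>k\<in>{1..dab a b}. Cmat a b j k * int (m k)))"
    by (simp add: quadC_def sum_distrib_left mult.assoc)
  then show ?thesis by (simp add: cf_quad_def sum_Cmat[OF supp] del: One_nat_def)
qed

lemma prodterm_eq:
  assumes supp: "\<forall>k. k \<notin> {1..dab a b} \<longrightarrow> m k = 0"
  shows "prodterm q a b L m = cf_prod q (Tset a b) (dab a b) L m"
  unfolding prodterm_def cf_prod_def
  by (intro prod.cong refl) (simp add: nvec_def tau_def sum_Cmat[OF supp] del: One_nat_def)

section \<open>Splitting off the first summation variable\<close>

lemma sum_atLeast1_Suc: "(\<Sum>j\<in>{1..Suc d}. f j) = f 1 + (\<Sum>j\<in>{1..d}. f (Suc j))"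
  by (induction d) (simp_all add: add.assoc)

lemma prod_atLeast1_Suc: "(\<Prod>j\<in>{1..Suc d}. f j) = f 1 * (\<Prod>j\<in>{1..d}. f (Suc j))"
  by (induction d) (simp_all add: mult.assoc)

text \<open>Truncated subtraction sends index 0 to \<open>m 0\<close>, which is 0 on
  \<open>vecs\<close>, so the support condition survives.\<close>

definition vec_cons :: "nat \<Rightarrow> (nat \<Rightarrow> nat) \<Rightarrow> nat \<Rightarrow> nat" where
  "vec_cons i m = (\<lambda>k. if k = 1 then i else m (k - 1))"

lemma vec_cons_1: "vec_cons i m (Suc 0) = i"
  by (simp add: vec_cons_def)

lemma vec_cons_Suc: "1 \<le> k \<Longrightarrow> vec_cons i m (Suc k) = m k"
  by (simp add: vec_cons_def)

lemma vecs_reindex: "(\<Sum>m\<in>vecs (Suc d) L. f m) = (\<Sum>i\<le>L. \<Sum>m\<in>vecs d L. f (vec_cons i m))"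
proof -
  have "(\<Sum>m\<in>vecs (Suc d) L. f m) = (\<Sum>(i, m)\<in>{..L} \<times> vecs d L. f (vec_cons i m))"
  \<comment> \<open>A plain shift would leave the first entry at index 0 of the tail, outside its
    support.\<close>
  proof (rule sum.reindex_bij_witness[of _ "\<lambda>(i, m). vec_cons i m"
        "\<lambda>m. (m 1, \<lambda>k. if k = 0 then 0 else m (Suc k))"])
    fix m assume m: "m \<in> vecs (Suc d) L"
    then have "m 0 = 0" by (auto simp: vecs_def)
    then show "(case (m 1, \<lambda>k. if k = 0 then 0 else m (Suc k)) of (i, m) \<Rightarrow> vec_cons i m) = m"
      by (auto simp: vec_cons_def fun_eq_iff le_Suc_eq)
    then show "(case (m 1, \<lambda>k. if k = 0 then 0 else m (Suc k)) of (i, m) \<Rightarrow> f (vec_cons i m)) = f m"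
      by simp
    show "(m 1, \<lambda>k. if k = 0 then 0 else m (Suc k)) \<in> {..L} \<times> vecs d L"
      using m by (auto simp: vecs_def)
  next
    fix x assume x: "x \<in> {..L} \<times> vecs d L"
    obtain i m where im: "x = (i, m)" by (cases x)
    have supp: "m k = 0" if "k \<notin> {1..d}" for k
      using x that by (auto simp: vecs_def im)
    then have "m 0 = 0" by simp
    then show "((case x of (i, m) \<Rightarrow> vec_cons i m) 1,
        \<lambda>k. if k = 0 then 0 else (case x of (i, m) \<Rightarrow> vec_cons i m) (Suc k)) = x"
      by (auto simp: im fun_eq_iff vec_cons_def)
    have "vec_cons i m k = 0" if "k \<notin> {1..Suc d}" for k
    proof (cases "k = 0")
      case False
      with that have "k \<noteq> 1" "k - 1 \<notin> {1..d}" by auto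
      with supp show ?thesis by (simp add: vec_cons_def)
    qed (simp add: vec_cons_def \<open>m 0 = 0\<close>)
    moreover have "vec_cons i m k \<le> L" for k
      using x by (auto simp: vec_cons_def vecs_def im)
    ultimately show "(case x of (i, m) \<Rightarrow> vec_cons i m) \<in> vecs (Suc d) L"
      by (simp add: vecs_def im)
  qed
  then show ?thesis by (simp add: sum.cartesian_product)
qed

context generic_q
begin

lemma Fab_eq_cf_sum: "Fab q a b L M = cf_sum q (a \<le> 2 * b) (Tset a b) (dab a b) L M"
proof -
  let ?g = "\<lambda>m :: nat \<Rightarrow> nat.
     if (\<forall>k. k \<notin> {1..dab a b} \<longrightarrow> m k = 0) then
       (if a \<le> 2 * b then
          q powi quadC a b m * qbinom q (2 * int L + int M - int (m 1)) (2 * int L) * prodterm q a b L m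
        else
          q powi (int L * (int L - 2 * int (m 1)) + quadC a b m)
            * qbinom q (int L + int M + int (m 1)) (2 * int L) * prodterm q a b L m)
     else 0"
  have "{m. ?g m \<noteq> 0} \<subseteq> vecs (dab a b) L"
  proof
    fix m assume "m \<in> {m. ?g m \<noteq> 0}"
    then have supp: "\<forall>k. k \<notin> {1..dab a b} \<longrightarrow> m k = 0" and "prodterm q a b L m \<noteq> 0"
      by (auto split: if_splits)
    then show "m \<in> vecs (dab a b) L"
      using cf_prod_nonzero_imp_vecs[of "dab a b" m q "Tset a b" L] prodterm_eq[of a b m q L] by metis
  qed
  then have "Sum_any ?g = sum ?g (vecs (dab a b) L)"
    by (rule Sum_any.expand_superset[OF finite_vecs])
  also have "\<dots> = cf_sum q (a \<le> 2 * b) (Tset a b) (dab a b) L M"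
    unfolding cf_sum_def
  proof (intro sum.cong refl)
    fix m assume "m \<in> vecs (dab a b) L"
    then have supp: "\<forall>k. k \<notin> {1..dab a b} \<longrightarrow> m k = 0" by (simp add: vecs_def)
    then show "?g m = cf_weight q (a \<le> 2 * b) L M (m 1) * (q powi cf_quad (Tset a b) (dab a b) m
        * cf_prod q (Tset a b) (dab a b) L m)"
      by (simp add: quadC_eq[OF supp] prodterm_eq[OF supp] cf_weight_def mult_ac flip: powi_mult_powi)
  qed
  finally show ?thesis by (simp add: Fab_def)
qed

text \<open>
  The factor with index \<open>1\<close> of the product for \<open>d + 1\<close> turns into the weight of the sum for \<open>d\<close>; whether
  \<open>1 \<in> T'\<close> decides which of the two weights arises.
\<close>

lemma cf_sum_Suc:
  assumes "1 \<le> d" and T': "\<And>j. 1 \<le> j \<Longrightarrow> Suc j \<in> T' \<longleftrightarrow> j \<in> T"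
  shows "cf_sum q low T' (Suc d) L M = (\<Sum>i\<le>L. cf_weight q low L M i * q powi (int i * int i)
           * cf_sum q (1 \<in> T') T d i (L - i))"
proof -
  have "(\<Sum>m\<in>vecs d L. cf_weight q low L M (vec_cons i m 1) * (q powi cf_quad T' (Suc d) (vec_cons i m)
          * cf_prod q T' (Suc d) L (vec_cons i m)))
    = cf_weight q low L M i * q powi (int i * int i) * cf_sum q (1 \<in> T') T d i (L - i)"
    if "i \<le> L" for i
  proof -
    have summand: "q powi cf_quad T' (Suc d) (vec_cons i m) * cf_prod q T' (Suc d) L (vec_cons i m)
      = q powi (int i * int i) * (cf_weight q (1 \<in> T') i (L - i) (m 1)
          * (q powi cf_quad T d m * cf_prod q T d i m))" if m: "m \<in> vecs d L" for m
    proof -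
      have "m 0 = 0" using m by (auto simp: vecs_def)
      \<comment> \<open>In the rows after the first, i occurs only at j = 1, with coefficient -1 in
        either kind of row. There it takes the place of L for the shorter vector.\<close>
      have row: "cf_row T' (vec_cons i m) (Suc j) = cf_row T m j - dlt (j = 1) * int i" if "1 \<le> j" for j
        using that T'[OF that] \<open>m 0 = 0\<close> by (cases j) (auto simp: cf_row_def dlt_def vec_cons_def)
      have row1: "cf_row T' (vec_cons i m) 1 = (if 1 \<in> T' then int i + int (m 1) else 2 * int i - int (m 1))"
        using \<open>m 0 = 0\<close> by (auto simp: cf_row_def vec_cons_def)
      have "cf_quad T' (Suc d) (vec_cons i m)
        = int i * cf_row T' (vec_cons i m) 1 + (\<Sum>j\<in>{1..d}. int (m j) * cf_row T' (vec_cons i m) (Suc j))"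
        unfolding cf_quad_def sum_atLeast1_Suc by (simp add: vec_cons_1 vec_cons_Suc)
      also have "(\<Sum>j\<in>{1..d}. int (m j) * cf_row T' (vec_cons i m) (Suc j))
        = (\<Sum>j\<in>{1..d}. int (m j) * cf_row T m j - (if j = 1 then int (m j) * int i else 0))"
        by (intro sum.cong refl) (auto simp: row dlt_def algebra_simps)
      also have "\<dots> = cf_quad T d m - int (m 1) * int i"
        using assms(1) by (simp add: sum_subtractf cf_quad_def)
      \<comment> \<open>The cross terms of i and \<open>m 1\<close> cancel if 1 is in T' and add up
        to -2 i \<open>m 1\<close> otherwise; the latter is the extra power of q in the weight for a
        > 2b.\<close>
      finally have quad: "cf_quad T' (Suc d) (vec_cons i m)
        = int i * int i + ((if 1 \<in> T' then 0 else int i * (int i - 2 * int (m 1))) + cf_quad T d m)"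
        by (cases "1 \<in> T'") (simp_all add: row1[unfolded One_nat_def] algebra_simps)
      \<comment> \<open>As 1 \<le> d, index 1 is not the last one, hence the factor 2 in front of
        i.\<close>
      have "cf_prod q T' (Suc d) L (vec_cons i m)
        = qbinom q (2 * int i + (int L - cf_row T' (vec_cons i m) 1)) (2 * int i) *
          (\<Prod>j\<in>{1..d}. qbinom q ((if j < d then 2 else 1) * int (m j) + - cf_row T' (vec_cons i m) (Suc j))
            ((if j < d then 2 else 1) * int (m j)))"
        using assms(1) unfolding cf_prod_def prod_atLeast1_Suc by (simp add: dlt_def vec_cons_1 vec_cons_Suc)
      also have "(\<Prod>j\<in>{1..d}. qbinom q ((if j < d then 2 else 1) * int (m j) + - cf_row T' (vec_cons i m) (Suc j))
            ((if j < d then 2 else 1) * int (m j))) = cf_prod q T d i m"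
        unfolding cf_prod_def by (intro prod.cong refl) (auto simp: row dlt_def)
      finally show ?thesis
        using \<open>i \<le> L\<close> unfolding quad
        by (simp add: row1[unfolded One_nat_def] vec_cons_1 cf_weight_def of_nat_diff algebra_simps flip: powi_mult_powi)
    qed
    \<comment> \<open>The inner sum may be cut from entries at most L to entries at most i.\<close>
    have "vecs d i \<subseteq> vecs d L" using \<open>i \<le> L\<close> by (auto simp: vecs_def intro: le_trans)
    moreover have "cf_prod q T d i m = 0" if "m \<in> vecs d L - vecs d i" for m
      using that cf_prod_nonzero_imp_vecs[of d m q T i] by (auto simp: vecs_def)
    ultimately have "cf_sum q (1 \<in> T') T d i (L - i)
      = (\<Sum>m\<in>vecs d L. cf_weight q (1 \<in> T') i (L - i) (m 1) * (q powi cf_quad T d m * cf_prod q T d i m))"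
      unfolding cf_sum_def by (intro sum.mono_neutral_left finite_vecs) auto
    then show ?thesis by (simp add: summand vec_cons_1 sum_distrib_left mult.assoc)
  qed
  then show ?thesis unfolding cf_sum_def[of _ low] vecs_reindex by simp
qed

text \<open>Here index 1 is the last one, so its factor is the binomial of i + (L - i) over
  i.\<close>

lemma cf_sum_1:
  "cf_sum q low {1} 1 L M = (\<Sum>i\<le>L. cf_weight q low L M i * q powi (int i * int i) * qbinom q (int L) (int i))"
proof -
  have "vecs 0 L = {\<lambda>_. 0}" by (auto simp: vecs_def)
  then have "cf_sum q low {1} (Suc 0) L M = (\<Sum>i\<le>L. cf_weight q low L M i * q powi (int i * int i) * qbinom q (int L) (int i))"
    unfolding cf_sum_def vecs_reindex
    by (intro sum.cong) (auto simp: cf_quad_def cf_prod_def cf_row_def dlt_def vec_cons_def)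
  then show ?thesis by simp
qed

section \<open>The recursion for the alternating sum\<close>

definition burge_sum :: "nat \<Rightarrow> nat \<Rightarrow> nat \<Rightarrow> nat \<Rightarrow> 'a" where
  "burge_sum a b L M = Sum_any (\<lambda>j::int. (-1) powi j * q powi (j * ((2 * int a * int b + 1) * j + 1) div 2)
            * Bq q (int L) (int M) (int a * j) (int b * j))"

text \<open>A free bound K lets the sums for all i \<le> L share one range of j, so that summations
  can be exchanged.\<close>

lemma burge_sum_eq:
  assumes "1 \<le> a" "L \<le> K"
  shows "burge_sum a b L M = (\<Sum>j=-int K..int K. (-1) powi j
     * q powi (j * ((2 * int a * int b + 1) * j + 1) div 2) * Bq q (int L) (int M) (int a * j) (int b * j))"
  unfolding burge_sum_def
proof (rule Sum_any.expand_superset, simp, rule subsetI)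
  fix j assume j: "j \<in> {j. (-1) powi j * q powi (j * ((2 * int a * int b + 1) * j + 1) div 2)
     * Bq q (int L) (int M) (int a * j) (int b * j) \<noteq> 0}"
  show "j \<in> {- int K..int K}"
  proof (rule ccontr)
    assume "j \<notin> {- int K..int K}"
    then have "int L < 1 * \<bar>j\<bar>" using assms by auto
    also have "\<dots> \<le> int a * \<bar>j\<bar>" using assms by (intro mult_right_mono) auto
    finally have "Bq q (int L) (int M) (int a * j) (int b * j) = 0"
      by (intro Bq_eq_0) (simp add: abs_mult)
    with j show False by simp
  qed
qed

text \<open>Passing from the pair (s, t) to (s + t, s) adds exactly the square produced by the Burge
  transform.\<close>

lemma burge_exponent:
  fixes j :: int
  shows "j * ((2 * (s + t) * s + 1) * j + 1) div 2 = j * ((2 * s * t + 1) * j + 1) div 2 + (s * j) * (s * j)"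
proof -
  have "j * ((2 * (s + t) * s + 1) * j + 1) = j * ((2 * s * t + 1) * j + 1) + ((s * j) * (s * j)) * 2"
    by (simp add: algebra_simps)
  then show ?thesis by simp
qed

text \<open>Apply \<open>burge_low\<close> to each term at (aj, bj), whose product is a b j^2 \<ge>
  0, and exchange the sums.\<close>

lemma burge_sum_low:
  assumes "1 \<le> a"
  shows "burge_sum (a + b) a L M
    = (\<Sum>i\<le>L. cf_weight q True L M i * q powi (int i * int i) * burge_sum a b i (L - i))"
proof -
  have nonneg: "0 \<le> (int a * j) * (int b * j)" for j
    by (simp add: mult.assoc mult.left_commute[of j] flip: power2_eq_square)
  let ?e = "\<lambda>j. (-1) powi j * q powi (j * ((2 * int a * int b + 1) * j + 1) div 2)"
  have "burge_sum (a + b) a L M = (\<Sum>j=-int L..int L. ?e j *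
      (q powi ((int a * j) * (int a * j)) * Bq q (int L) (int M) (int a * j + int b * j) (int a * j)))"
    using assms burge_exponent[of _ "int a" "int b"]
    by (subst burge_sum_eq[where K = L]) (simp_all add: powi_mult_powi[symmetric] mult.assoc distrib_right)
  also have "\<dots> = (\<Sum>j=-int L..int L. \<Sum>i\<le>L. cf_weight q True L M i * q powi (int i * int i) *
      (?e j * Bq q (int i) (int (L - i)) (int a * j) (int b * j)))"
    by (subst burge_low[OF nonneg, symmetric]) (simp_all add: sum_distrib_left cf_weight_def mult_ac)
  also have "\<dots> = (\<Sum>i\<le>L. cf_weight q True L M i * q powi (int i * int i) * burge_sum a b i (L - i))"
    by (subst sum.swap) (simp add: burge_sum_eq[OF assms, where K = L] sum_distrib_left)
  finally show ?thesis .
qed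

lemma burge_sum_high:
  assumes "1 \<le> a"
  shows "burge_sum (a + b) b L M
    = (\<Sum>i\<le>L. cf_weight q False L M i * q powi (int i * int i) * burge_sum a b i (L - i))"
proof -
  have nonneg: "0 \<le> (int a * j) * (int b * j)" for j
    by (simp add: mult.assoc mult.left_commute[of j] flip: power2_eq_square)
  let ?e = "\<lambda>j. (-1) powi j * q powi (j * ((2 * int a * int b + 1) * j + 1) div 2)"
  have "burge_sum (a + b) b L M = (\<Sum>j=-int L..int L. ?e j *
      (q powi ((int b * j) * (int b * j)) * Bq q (int L) (int M) (int a * j + int b * j) (int b * j)))"
    using assms burge_exponent[of _ "int b" "int a"]
    by (subst burge_sum_eq[where K = L])
      (simp_all add: powi_mult_powi[symmetric] mult.assoc distrib_right add.commute mult.left_commute)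
  also have "\<dots> = (\<Sum>j=-int L..int L. \<Sum>i\<le>L. cf_weight q False L M i * q powi (int i * int i) *
      (?e j * Bq q (int i) (int (L - i)) (int a * j) (int b * j)))"
    by (subst burge_high[OF nonneg, symmetric]) (simp_all add: sum_distrib_left cf_weight_def mult_ac)
  also have "\<dots> = (\<Sum>i\<le>L. cf_weight q False L M i * q powi (int i * int i) * burge_sum a b i (L - i))"
    by (subst sum.swap) (simp add: burge_sum_eq[OF assms, where K = L] sum_distrib_left)
  finally show ?thesis .
qed

lemma burge_sum_1_1: "burge_sum 1 1 L M = qbinom q (int L + int M) (int L)"
  using alternating_sum_Bq_diag[of L M] by (simp add: burge_sum_eq[where K = L])

text \<open>Both moves lead from (1, 1) to (2, 1), and the inner sum at (i, L - i) is the binomial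
  of L over i; hence both weights give the same value.\<close>

lemma burge_sum_2_1: "burge_sum 2 1 L M = cf_sum q low {1} 1 L M"
proof (cases low)
  case True
  then show ?thesis
    using burge_sum_low[of 1 1 L M, unfolded burge_sum_1_1] unfolding cf_sum_1
    by (simp add: of_nat_diff numeral_2_eq_2)
next
  case False
  then show ?thesis
    using burge_sum_high[of 1 1 L M, unfolded burge_sum_1_1] unfolding cf_sum_1
    by (simp add: of_nat_diff numeral_2_eq_2)
qed

end

section \<open>Continued fractions\<close>

text \<open>The predicate under the description operator in \<open>cf_list\<close>, named so that
  explicit lists can be tested against it.\<close>

definition is_cf :: "nat \<Rightarrow> nat \<Rightarrow> nat list \<Rightarrow> bool" where
  "is_cf a b xs \<longleftrightarrow> xs \<noteq> [] \<and> (\<forall>x\<in>set xs. 0 < x) \<and> cfval xs = cf_val a b \<and>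
       (if (a, b) = (2, 1) then xs = [1] else 2 \<le> last xs)"

lemma cfval_gt_1:
  assumes "xs \<noteq> []" "\<forall>x\<in>set xs. 0 < x" "2 \<le> last xs"
  shows "1 < cfval xs"
  using assms
proof (induction xs rule: cfval.induct)
  case (3 x y ys)
  then have "1 < cfval (y # ys)" "0 < x" by auto
  moreover from this have "0 < 1 / cfval (y # ys)" by simp
  moreover have "(1::rat) \<le> of_nat x" using \<open>0 < x\<close> by (simp add: Suc_leI)
  ultimately show ?case by (simp only: cfval.simps)
qed auto

lemma floor_cfval:
  assumes "\<forall>x\<in>set (x # xs). 0 < x" "2 \<le> last (x # xs)"
  shows "\<lfloor>cfval (x # xs)\<rfloor> = int x"
proof (cases xs)
  case (Cons y ys)
  then have "1 < cfval xs" using assms by (intro cfval_gt_1) auto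
  then have "0 < 1 / cfval xs" "1 / cfval xs < 1" by (auto simp: field_simps)
  then show ?thesis using Cons by (simp add: floor_eq_iff)
qed simp

text \<open>The first entry is the floor of the value, and the rest determines the value of the
  tail. The condition on the last entry rules out a tail of value 1.\<close>

lemma cfval_inject:
  assumes "xs \<noteq> []" "\<forall>x\<in>set xs. 0 < x" "2 \<le> last xs"
    and "ys \<noteq> []" "\<forall>x\<in>set ys. 0 < x" "2 \<le> last ys"
    and "cfval xs = cfval ys"
  shows "xs = ys"
  using assms
proof (induction xs arbitrary: ys)
  case (Cons x xs)
  then obtain y zs where ys: "ys = y # zs" by (cases ys) auto
  have x: "cfval (x # xs) = of_nat x + (if xs = [] then 0 else 1 / cfval xs)" for x xs
    by (cases xs) auto
  have "\<lfloor>cfval (x # xs)\<rfloor> = int x" using Cons.prems by (intro floor_cfval) auto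
  moreover have "\<lfloor>cfval (y # zs)\<rfloor> = int y" using Cons.prems ys by (intro floor_cfval) auto
  ultimately have "x = y" using Cons.prems ys by simp
  with Cons.prems have "(if xs = [] then 0 else 1 / cfval xs) = (if zs = [] then 0 else 1 / cfval zs)"
    unfolding ys x by simp
  moreover have "1 < cfval xs" if "xs \<noteq> []" using that Cons.prems by (intro cfval_gt_1) auto
  moreover have "1 < cfval zs" if "zs \<noteq> []" using that Cons.prems ys by (intro cfval_gt_1) auto
  ultimately have "(xs = [] \<and> zs = []) \<or> (xs \<noteq> [] \<and> zs \<noteq> [] \<and> cfval xs = cfval zs)"
    by (cases "xs = []"; cases "zs = []") auto
  then have "xs = zs"
  proof
    assume "xs \<noteq> [] \<and> zs \<noteq> [] \<and> cfval xs = cfval zs"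
    then show "xs = zs" using Cons.prems ys by (intro Cons.IH) auto
  qed simp
  with \<open>x = y\<close> ys show ?case by simp
qed simp

lemma cf_list_eq:
  assumes "is_cf a b xs"
  shows "cf_list a b = xs"
proof -
  have "ys = xs" if "is_cf a b ys" for ys
  proof (cases "(a, b) = (2, 1)")
    case True
    then show ?thesis using assms that by (simp add: is_cf_def)
  next
    case False
    then show ?thesis using assms that by (intro cfval_inject) (simp_all only: is_cf_def, auto)
  qed
  with assms show ?thesis
    unfolding cf_list_def is_cf_def[symmetric] by (rule the_equality)
qed

definition psums :: "nat list \<Rightarrow> nat set" where
  "psums xs = {sum_list (take j xs) | j. 1 \<le> j \<and> j \<le> length xs}"

text \<open>Prepending 1 shifts the set by one and adds 1; incrementing the first entry only shifts
  it. Both fit the assumption on T' in \<open>cf_sum_Suc\<close>.\<close>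

lemma psums_Cons: "psums (x # xs) = insert x ((+) x ` psums xs)"
proof -
  have "psums (x # xs) = (\<lambda>j. sum_list (take j (x # xs))) ` {Suc 0..Suc (length xs)}"
    by (auto simp: psums_def)
  also have "{Suc 0..Suc (length xs)} = insert (Suc 0) (Suc ` {1..length xs})"
    by (auto simp: image_Suc_atLeastAtMost)
  also have "(\<lambda>j. sum_list (take j (x # xs))) ` \<dots> = insert x ((\<lambda>j. x + sum_list (take j xs)) ` {1..length xs})"
    by (simp only: image_insert image_image) simp
  also have "\<dots> = insert x ((+) x ` psums xs)"
  proof -
    have "psums xs = (\<lambda>j. sum_list (take j xs)) ` {1..length xs}" by (auto simp: psums_def)
    then show ?thesis by (simp only: image_image)
  qed
  finally show ?thesis .
qed

lemma Tset_eq: "is_cf a b xs \<Longrightarrow> Tset a b = psums xs"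
  by (simp add: Tset_def tpt_def psums_def cf_list_eq)

lemma dab_eq: "is_cf a b xs \<Longrightarrow> dab a b = sum_list xs"
  by (simp add: dab_def tpt_def cf_list_eq)

section \<open>The Burge tree\<close>

context generic_q
begin

definition burge_id :: "nat \<Rightarrow> nat \<Rightarrow> bool \<Rightarrow> nat list \<Rightarrow> bool" where
  "burge_id a b low xs \<longleftrightarrow> (\<forall>L M. burge_sum a b L M = cf_sum q low (psums xs) (sum_list xs) L M)"

lemma burge_id_step:
  assumes "1 \<le> a" "1 \<le> sum_list xs" "sum_list ys = Suc (sum_list xs)"
    and "\<And>j. 1 \<le> j \<Longrightarrow> Suc j \<in> psums ys \<longleftrightarrow> j \<in> psums xs"
    and "burge_id a b (1 \<in> psums ys) xs"
  shows "burge_id (a + b) a True ys" "burge_id (a + b) b False ys"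
  using assms burge_sum_low[OF assms(1)] burge_sum_high[OF assms(1)]
    cf_sum_Suc[OF assms(2,4)] unfolding burge_id_def by simp_all

text \<open>Both new pairs have continued fraction value a/b. With v the value for (a, b), this is 1
  + 1/v if a < 2b and 1 + v otherwise, so one list serves both.\<close>

lemma burge_step:
  assumes "coprime a b" "1 \<le> b" "b < a" "is_cf a b xs"
    and low: "a \<le> 2 * b \<Longrightarrow> burge_id a b True xs" and high: "2 * b \<le> a \<Longrightarrow> burge_id a b False xs"
  obtains ys where "is_cf (a + b) a ys" "is_cf (a + b) b ys"
    "burge_id (a + b) a True ys" "burge_id (a + b) b False ys"
proof -
  obtain x zs where xs: "xs = x # zs" and "0 < x" and pos: "\<forall>x\<in>set xs. 0 < x"
    using assms(4) by (cases xs) (auto simp: is_cf_def)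
  have ab: "cf_val (a + b) a = of_nat a / of_nat b" "cf_val (a + b) b = of_nat a / of_nat b"
    using assms by (auto simp: cf_val_def field_simps)
  have sum_pos: "1 \<le> sum_list xs" using xs \<open>0 < x\<close> by simp
  show ?thesis
  proof (cases "a < 2 * b")
    case True
    let ?ys = "1 # xs"
    have "cfval ?ys = of_nat a / of_nat b"
    proof -
      have "cfval xs = inverse (of_nat a / of_nat b - 1)"
        using assms True by (auto simp: is_cf_def cf_val_def)
      then show ?thesis by (simp add: xs inverse_eq_divide)
    qed
    moreover have "2 \<le> last xs" using assms True by (auto simp: is_cf_def)
    ultimately have "is_cf (a + b) a ?ys" "is_cf (a + b) b ?ys"
      using pos assms unfolding is_cf_def ab by (auto simp: xs)
    moreover have "1 \<in> psums ?ys" "\<And>j. 1 \<le> j \<Longrightarrow> Suc j \<in> psums ?ys \<longleftrightarrow> j \<in> psums xs"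
      by (auto simp: psums_Cons)
    then have "burge_id (a + b) a True ?ys" "burge_id (a + b) b False ?ys"
      using burge_id_step[of a xs ?ys b] assms True sum_pos by simp_all
    ultimately show ?thesis by (rule that)
  next
    case False
    let ?ys = "Suc x # zs"
    have "cfval xs = of_nat a / of_nat b - 1"
    proof (cases "a = 2 * b")
      case True
      with assms show ?thesis by (auto simp: is_cf_def cf_val_def)
    next
      case 2: False
      with False assms show ?thesis by (auto simp: is_cf_def cf_val_def)
    qed
    then have "cfval ?ys = of_nat a / of_nat b"
      by (cases zs) (auto simp: xs)
    \<comment> \<open>The exceptional list [1] of (2, 1) becomes [2], which meets the general
      normalisation.\<close>
    moreover have "2 \<le> last ?ys"
      using assms(4) \<open>0 < x\<close> by (auto simp: is_cf_def xs split: if_splits)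
    ultimately have "is_cf (a + b) a ?ys" "is_cf (a + b) b ?ys"
      using pos assms unfolding is_cf_def ab by (auto simp: xs)
    moreover have "1 \<notin> psums ?ys" "\<And>j. 1 \<le> j \<Longrightarrow> Suc j \<in> psums ?ys \<longleftrightarrow> j \<in> psums xs"
      using \<open>0 < x\<close> by (auto simp: psums_Cons xs)
    then have "burge_id (a + b) a True ?ys" "burge_id (a + b) b False ?ys"
      using burge_id_step[of a xs ?ys b] assms False sum_pos by (simp_all add: xs)
    ultimately show ?thesis by (rule that)
  qed
qed

text \<open>
  At the root \<open>(2, 1)\<close> both forms of the sum are needed, as it is continued to \<open>(3, 1)\<close> and \<open>(3, 2)\<close>
  by incrementing the entry of \<open>[1]\<close>; hence the overlap of the two conditions at \<open>a = 2b\<close>.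
\<close>

lemma burge_tree:
  assumes "coprime a b" "1 \<le> b" "b < a"
  shows "\<exists>xs. is_cf a b xs \<and> (a \<le> 2 * b \<longrightarrow> burge_id a b True xs) \<and> (2 * b \<le> a \<longrightarrow> burge_id a b False xs)"
  using assms
proof (induction a arbitrary: b rule: less_induct)
  case (less a)
  define c where "c = a - b"
  have c: "a = b + c" "1 \<le> c" "coprime b c" using less.prems
    by (auto simp: c_def coprime_iff_gcd_eq_1 gcd_diff1_nat gcd.commute[of b])
  \<comment> \<open>Undo one move: if c < b then (a, b) comes from (b, c), if b < c from (c, b); c =
    b forces (2, 1) by coprimality.\<close>
  consider "c = b" | "c < b" | "b < c" by linarith
  then show ?case
  proof cases
    case 1
    with c have "b = 1" "a = 2" by auto
    moreover have "is_cf 2 1 [1]" by (simp add: is_cf_def cf_val_def)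
    moreover have "burge_id 2 1 low [1]" for low
      using burge_sum_2_1 by (simp add: burge_id_def psums_Cons) (simp add: psums_def)
    ultimately show ?thesis by blast
  next
    case 2
    with less.IH[of b c] c less.prems obtain xs where "is_cf b c xs"
      "b \<le> 2 * c \<Longrightarrow> burge_id b c True xs" "2 * c \<le> b \<Longrightarrow> burge_id b c False xs" by auto
    with burge_step[of b c xs] 2 c obtain ys where "is_cf a b ys" "burge_id a b True ys" by metis
    with 2 c show ?thesis by auto
  next
    case 3
    with less.IH[of c b] c less.prems obtain xs where "is_cf c b xs"
      "c \<le> 2 * b \<Longrightarrow> burge_id c b True xs" "2 * b \<le> c \<Longrightarrow> burge_id c b False xs"
      by (auto simp: coprime_commute)
    with burge_step[of c b xs] 3 c less.prems obtain ys where "is_cf a b ys" "burge_id a b False ys"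
      by (metis add.commute coprime_commute)
    with 3 c show ?thesis by auto
  qed
qed

lemma burge_sum_eq_Fab:
  assumes "coprime a b" "1 \<le> b" "b < a"
  shows "burge_sum a b L M = Fab q a b L M"
proof -
  obtain xs where xs: "is_cf a b xs" "a \<le> 2 * b \<Longrightarrow> burge_id a b True xs" "2 * b \<le> a \<Longrightarrow> burge_id a b False xs"
    using burge_tree[OF assms] by blast
  show ?thesis
    using xs by (cases "a \<le> 2 * b") (auto simp: Fab_eq_cf_sum burge_id_def Tset_eq dab_eq)
qed

end

section \<open>Specialisation to the formal variable\<close>

lemma qvar_power: "qvar ^ n = Fract (monom 1 n) 1"
  by (induction n) (simp_all add: qvar_def One_fract_def monom_Suc mult.commute)

interpretation qvar: generic_q qvar
proof
  show "qvar \<noteq> 0" by (simp add: qvar_def Zero_fract_def eq_fract)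
  show "qvar ^ n \<noteq> 1" if "0 < n" for n
    using that by (simp add: qvar_power One_fract_def eq_fract monom_eq_1_iff)
qed

theorem theorem3p3:
  fixes L M a b :: nat
  assumes "coprime a b" and "1 \<le> b" and "b < a"
  shows "Sum_any (\<lambda>j::int. (-1) powi j * qvar powi (j * ((2 * int a * int b + 1) * j + 1) div 2)
            * Bq qvar (int L) (int M) (int a * j) (int b * j))
         = Fab qvar a b L M"
  using qvar.burge_sum_eq_Fab[OF assms] by (simp only: qvar.burge_sum_def)

end
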